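(* Let $\mathbf{X}\in\mathbb{R}^{d\times n}$ and $\beta,\lambda>0$. Put $u_i=\|\mathbf{X}_{i:}\|_2^2$ for $i=1,\dots,d$ and $v_j=\|\mathbf{X}_{:j}\|_2^2$ for $j=1,\dots,n$. For serial samplings with probabilities $p\in\mathbb{R}^d$, $p_i>0$, $\sum_{i=1}^d p_i=1$ (resp. $q\in\mathbb{R}^n$, $q_j>0$, $\sum_{j=1}^n q_j=1$), define the total expected complexities $$T_P(p)=\left(\max_{1\le i\le d}\frac{\beta u_i+\lambda n}{p_i\lambda n}\right)\left(\sum_{i=1}^d p_i\|\mathbf{X}_{i:}\|_0\right),\qquad T_D(q)=\left(\max_{1\le j\le n}\frac{\beta v_j+\lambda n}{q_j\lambda n}\right)\left(\sum_{j=1}^n q_j\|\mathbf{X}_{:j}\|_0\right).$$ Then the optimal serial sampling, i.e. the serial sampling minimizing the total expected complexity $T_P$ (resp. $T_D$), is the importance sampling: the minimizer of $T_P$ is $p^*$ and the minimizer of $T_D$ is $q^*$, where $$p_i^*=\frac{\beta u_i+\lambda n}{\sum_{l=1}^d(\beta u_l+\lambda n)},\quad i=1,\dots,d,\qquad q_j^*=\frac{\beta v_j+\lambda n}{\sum_{l=1}^n(\beta v_l+\lambda n)},\quad j=1,\dots,n.$$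
   Context: $\mathbf{X}_{i:}$ and $\mathbf{X}_{:j}$ denote the $i$-th row and $j$-th column of $\mathbf{X}$, $\|\cdot\|_0$ denotes the number of nonzero entries, and $\|\cdot\|_2$ is the Euclidean norm. Background: randomized coordinate descent is applied to the primal ($d$-dimensional) or dual ($n$-dimensional) form of L2-regularized empirical risk minimization with data matrix $\mathbf{X}$, convex $\beta$-smooth losses and regularization constant $\lambda$. A serial sampling picks exactly one coordinate $i\in\{1,\dots,d\}$ (resp. $j\in\{1,\dots,n\}$) per iteration, with probability $p_i$ (resp. $q_j$). $T_P$ (resp. $T_D$) is the product of the bound on the number of iterations, without its logarithmic factor (the first bracket), and the expected cost of one iteration (the second bracket). Importance sampling is the serial sampling that minimizes the bound on the number of iterations alone; its probabilities are $p^*$ (resp. $q^*$).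
   Formalization: p* (resp. q* ) is proved to be a minimizer for every X, but to be the only minimizer of T_P (resp. T_D) only if every row (resp. column) of X is nonzero; without this uniqueness fails, e.g. X = 0 with d ≥ 2 (resp. n ≥ 2) makes every sampling optimal. *)

theory Defs
  imports "HOL-Analysis.Analysis"
begin

text \<open>A matrix with \<open>d\<close> rows and \<open>n\<close> columns has type \<^typ>\<open>real^'n^'d\<close>, with
  \<open>d = CARD('d)\<close> and \<open>n = CARD('n)\<close>. The regularization term is \<open>lam * n\<close> in the dual
  quantities as well, so these are not the primal ones of the transposed matrix.\<close>

definition nnz :: "real^'k \<Rightarrow> nat"
  where "nnz x = card {i. x $ i \<noteq> 0}"

definition serial_sampling :: "real^'k \<Rightarrow> bool"
  where "serial_sampling p \<longleftrightarrow> (\<forall>i. p $ i > 0) \<and> (\<Sum>i\<in>UNIV. p $ i) = 1"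

definition primal_u :: "real^'n^'d \<Rightarrow> 'd \<Rightarrow> real"
  where "primal_u X i = (norm (row i X))\<^sup>2"

definition dual_v :: "real^'n^'d \<Rightarrow> 'n \<Rightarrow> real"
  where "dual_v X j = (norm (column j X))\<^sup>2"

text \<open>Bounds on the number of iterations, without their logarithmic factor.\<close>

definition primal_iterations :: "real \<Rightarrow> real \<Rightarrow> real^'n^'d \<Rightarrow> real^'d \<Rightarrow> real"
  where "primal_iterations \<beta> lam X p =
    (MAX i\<in>UNIV. (\<beta> * primal_u X i + lam * real CARD('n)) / (p $ i * lam * real CARD('n)))"

definition dual_iterations :: "real \<Rightarrow> real \<Rightarrow> real^'n^'d \<Rightarrow> real^'n \<Rightarrow> real"
  where "dual_iterations \<beta> lam X q =
    (MAX j\<in>UNIV. (\<beta> * dual_v X j + lam * real CARD('n)) / (q $ j * lam * real CARD('n)))"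

text \<open>Expected costs of one iteration.\<close>

definition primal_cost :: "real^'n^'d \<Rightarrow> real^'d \<Rightarrow> real"
  where "primal_cost X p = (\<Sum>i\<in>UNIV. p $ i * real (nnz (row i X)))"

definition dual_cost :: "real^'n^'d \<Rightarrow> real^'n \<Rightarrow> real"
  where "dual_cost X q = (\<Sum>j\<in>UNIV. q $ j * real (nnz (column j X)))"

definition T_P :: "real \<Rightarrow> real \<Rightarrow> real^'n^'d \<Rightarrow> real^'d \<Rightarrow> real"
  where "T_P \<beta> lam X p = primal_iterations \<beta> lam X p * primal_cost X p"

definition T_D :: "real \<Rightarrow> real \<Rightarrow> real^'n^'d \<Rightarrow> real^'n \<Rightarrow> real"
  where "T_D \<beta> lam X q = dual_iterations \<beta> lam X q * dual_cost X q"

text \<open>An importance sampling minimizes the iteration bound alone.\<close>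

definition primal_importance_sampling :: "real \<Rightarrow> real \<Rightarrow> real^'n^'d \<Rightarrow> real^'d \<Rightarrow> bool"
  where "primal_importance_sampling \<beta> lam X p \<longleftrightarrow>
    is_arg_min (primal_iterations \<beta> lam X) serial_sampling p"

definition dual_importance_sampling :: "real \<Rightarrow> real \<Rightarrow> real^'n^'d \<Rightarrow> real^'n \<Rightarrow> bool"
  where "dual_importance_sampling \<beta> lam X q \<longleftrightarrow>
    is_arg_min (dual_iterations \<beta> lam X) serial_sampling q"

definition p_star :: "real \<Rightarrow> real \<Rightarrow> real^'n^'d \<Rightarrow> real^'d"
  where "p_star \<beta> lam X = (\<chi> i. (\<beta> * primal_u X i + lam * real CARD('n)) /
    (\<Sum>l\<in>UNIV. (\<beta> * primal_u X l + lam * real CARD('n))))"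

definition q_star :: "real \<Rightarrow> real \<Rightarrow> real^'n^'d \<Rightarrow> real^'n"
  where "q_star \<beta> lam X = (\<chi> j. (\<beta> * dual_v X j + lam * real CARD('n)) /
    (\<Sum>l\<in>UNIV. (\<beta> * dual_v X l + lam * real CARD('n))))"

end

theory Submission
  imports Defs
begin

text \<open>With weights \<open>w\<close>, costs \<open>c\<close> and \<open>M = max\<^sub>i w\<^sub>i / (p\<^sub>i a b)\<close>, every \<open>i\<close> satisfies
  \<open>w\<^sub>i / (a b) \<le> M p\<^sub>i\<close>. Multiplying by \<open>c\<^sub>i\<close> and summing bounds \<open>M \<Sum>\<^sub>i p\<^sub>i c\<^sub>i\<close> from below by
  \<open>\<Sum>\<^sub>i w\<^sub>i c\<^sub>i / (a b)\<close>, which does not depend on \<open>p\<close> and is attained when \<open>p\<close> is proportional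
  to \<open>w\<close>. If all costs are positive, equality forces this proportionality. The iteration
  bound alone is the case of unit costs.\<close>

text \<open>Common form of both iteration bounds: \<open>a\<close> and \<open>b\<close> stand for
  \<open>lam\<close> and the number of columns. Since \<open>b\<close> is a parameter and not
  \<open>CARD('k)\<close>, the same facts serve rows and columns.\<close>

definition max_ratio :: "('k::finite \<Rightarrow> real) \<Rightarrow> real \<Rightarrow> real \<Rightarrow> real^'k \<Rightarrow> real"
  where "max_ratio w a b p = (MAX i\<in>UNIV. w i / (p $ i * a * b))"

definition normalized :: "('k::finite \<Rightarrow> real) \<Rightarrow> real^'k"
  where "normalized w = (\<chi> i. w i / (\<Sum>l\<in>UNIV. w l))"

text \<open>Turns the condition on nonzero rows or columns into positivity of the costs.\<close>

lemma nnz_pos_iff: "0 < nnz x \<longleftrightarrow> x \<noteq> 0"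
  by (auto simp: nnz_def card_gt_0_iff vec_eq_iff)

text \<open>Allows an objective to be rewritten with facts that hold only on the feasible set, such
  as probabilities summing to 1.\<close>

lemma is_arg_min_cong:
  assumes "\<And>x. P x \<Longrightarrow> f x = g x"
  shows "is_arg_min f P x \<longleftrightarrow> is_arg_min g P x"
  using assms by (auto simp: is_arg_min_def)

context
  fixes w :: "'k::finite \<Rightarrow> real" and a b :: real
  assumes w: "\<And>i. 0 < w i" and a: "0 < a" and b: "0 < b"
begin

lemma sum_weights_pos: "0 < (\<Sum>i\<in>UNIV. w i)"
  by (simp add: sum_pos w)

lemma serial_sampling_normalized: "serial_sampling (normalized w)"
  using sum_weights_pos w
  by (simp add: serial_sampling_def normalized_def flip: sum_divide_distrib)

text \<open>Normalized weights make all the ratios equal, so the maximum is their common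
  value.\<close>

lemma max_ratio_normalized: "max_ratio w a b (normalized w) = (\<Sum>i\<in>UNIV. w i) / (a * b)"
proof -
  have "w i / (normalized w $ i * a * b) = (\<Sum>i\<in>UNIV. w i) / (a * b)" for i
    using w[of i] by (simp add: normalized_def)
  then show ?thesis
    by (simp add: max_ratio_def)
qed

lemma complexity_normalized:
  "max_ratio w a b (normalized w) * (\<Sum>i\<in>UNIV. normalized w $ i * c i) =
    (\<Sum>i\<in>UNIV. w i * c i) / (a * b)"
  using sum_weights_pos unfolding max_ratio_normalized
  by (simp add: normalized_def flip: sum_divide_distrib)

lemma weight_le_max_ratio:
  assumes "serial_sampling p"
  shows "w i / (a * b) \<le> max_ratio w a b p * p $ i"
proof -
  have p: "0 < p $ i"
    using assms by (simp add: serial_sampling_def)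
  have "w i / (p $ i * a * b) \<le> max_ratio w a b p"
    unfolding max_ratio_def by (rule Max_ge) auto
  then have "w i / (p $ i * a * b) * p $ i \<le> max_ratio w a b p * p $ i"
    using p by (intro mult_right_mono) auto
  then show ?thesis
    using p by simp
qed

lemma complexity_ge:
  assumes "serial_sampling p" and "\<And>i. 0 \<le> c i"
  shows "(\<Sum>i\<in>UNIV. w i * c i) / (a * b) \<le> max_ratio w a b p * (\<Sum>i\<in>UNIV. p $ i * c i)"
proof -
  have "(\<Sum>i\<in>UNIV. w i / (a * b) * c i) \<le> (\<Sum>i\<in>UNIV. max_ratio w a b p * p $ i * c i)"
    using assms by (intro sum_mono mult_right_mono weight_le_max_ratio) auto
  then show ?thesis
    by (simp add: sum_divide_distrib sum_distrib_left mult.assoc)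
qed

text \<open>The gap in the lower bound is a sum of nonnegative slacks times positive costs. If it
  vanishes, so does every slack.\<close>

lemma complexity_eq_imp_normalized:
  assumes p: "serial_sampling p" and c: "\<And>i. 0 < c i"
    and eq: "max_ratio w a b p * (\<Sum>i\<in>UNIV. p $ i * c i) = (\<Sum>i\<in>UNIV. w i * c i) / (a * b)"
  shows "p = normalized w"
proof -
  let ?M = "max_ratio w a b p"
  have "(\<Sum>i\<in>UNIV. (?M * p $ i - w i / (a * b)) * c i) = 0"
    using eq by (simp add: sum_divide_distrib sum_distrib_left left_diff_distrib
        sum_subtractf mult.assoc)
  moreover have "0 \<le> (?M * p $ i - w i / (a * b)) * c i" for i
    using weight_le_max_ratio[OF p, of i] c[of i] by simp
  ultimately have "(?M * p $ i - w i / (a * b)) * c i = 0" for i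
    by (simp add: sum_nonneg_eq_0_iff)
  then have tight: "?M * p $ i = w i / (a * b)" for i
    by (metis c eq_iff_diff_eq_0 less_irrefl mult_eq_0_iff)
  \<comment> \<open>Summing the tight equalities over all coordinates determines \<open>?M\<close>,
    because the probabilities sum to 1.\<close>
  have "(\<Sum>i\<in>UNIV. ?M * p $ i) = ?M"
    using p by (simp add: serial_sampling_def flip: sum_distrib_left)
  then have "?M = (\<Sum>i\<in>UNIV. w i) / (a * b)"
    by (simp add: tight flip: sum_divide_distrib)
  then have "p $ i = w i / (\<Sum>l\<in>UNIV. w l)" for i
    using tight[of i] sum_weights_pos a b by (simp add: field_simps)
  then show ?thesis
    by (simp add: vec_eq_iff normalized_def)
qed

lemma normalized_is_arg_min:
  assumes "\<And>i. 0 \<le> c i"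
  shows "is_arg_min (\<lambda>p. max_ratio w a b p * (\<Sum>i\<in>UNIV. p $ i * c i))
    serial_sampling (normalized w)"
  using complexity_ge[of _ c] assms serial_sampling_normalized
  by (auto simp: is_arg_min_linorder complexity_normalized)

text \<open>Positive costs give uniqueness: a coordinate of zero cost could take extra probability
  from the others, scaled down in proportion, without changing the product.\<close>

lemma is_arg_min_iff_normalized:
  assumes c: "\<And>i. 0 < c i"
  shows "is_arg_min (\<lambda>p. max_ratio w a b p * (\<Sum>i\<in>UNIV. p $ i * c i)) serial_sampling p
    \<longleftrightarrow> p = normalized w" (is "is_arg_min ?f _ _ \<longleftrightarrow> _")
proof
  assume min: "is_arg_min ?f serial_sampling p"
  then have p: "serial_sampling p" and "?f p \<le> ?f (normalized w)"
    using serial_sampling_normalized by (auto simp: is_arg_min_linorder)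
  \<comment> \<open>The value at a minimizer is squeezed between the general lower bound and the
    value at \<open>normalized w\<close>, which coincide.\<close>
  then have "?f p = (\<Sum>i\<in>UNIV. w i * c i) / (a * b)"
    using complexity_ge[of p c] c by (simp add: complexity_normalized less_imp_le order.antisym)
  then show "p = normalized w"
    using complexity_eq_imp_normalized[OF p c] by simp
qed (simp add: normalized_is_arg_min c less_imp_le)

text \<open>On serial samplings the expected unit cost is 1, so the product reduces to the iteration
  bound.\<close>

lemma max_ratio_is_arg_min_iff:
  "is_arg_min (max_ratio w a b) serial_sampling p \<longleftrightarrow> p = normalized w"
proof -
  have "is_arg_min (max_ratio w a b) serial_sampling p \<longleftrightarrow>
      is_arg_min (\<lambda>p. max_ratio w a b p * (\<Sum>i\<in>UNIV. p $ i * 1)) serial_sampling p"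
    by (rule is_arg_min_cong) (simp add: serial_sampling_def)
  then show ?thesis
    using is_arg_min_iff_normalized[of "\<lambda>_. 1" p] by simp
qed

end

theorem theorem2:
  fixes X :: "real^'n^'d" and \<beta> lam :: real
  assumes "\<beta> > 0" and "lam > 0"
  shows "((\<forall>p. primal_importance_sampling \<beta> lam X p \<longleftrightarrow> p = p_star \<beta> lam X) \<and>
          is_arg_min (T_P \<beta> lam X) serial_sampling (p_star \<beta> lam X) \<and>
          ((\<forall>i. row i X \<noteq> 0) \<longrightarrow>
            (\<forall>p. is_arg_min (T_P \<beta> lam X) serial_sampling p \<longrightarrow> p = p_star \<beta> lam X))) \<and>
         ((\<forall>q. dual_importance_sampling \<beta> lam X q \<longleftrightarrow> q = q_star \<beta> lam X) \<and>
          is_arg_min (T_D \<beta> lam X) serial_sampling (q_star \<beta> lam X) \<and>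
          ((\<forall>j. column j X \<noteq> 0) \<longrightarrow>
            (\<forall>q. is_arg_min (T_D \<beta> lam X) serial_sampling q \<longrightarrow> q = q_star \<beta> lam X)))"
proof -
  let ?w = "\<lambda>i. \<beta> * primal_u X i + lam * real CARD('n)"
  let ?w' = "\<lambda>j. \<beta> * dual_v X j + lam * real CARD('n)"
  have n: "0 < real CARD('n)"
    by simp
  \<comment> \<open>The regularization term is strictly positive, so even a zero row has positive
    weight.\<close>
  have w: "0 < ?w i" for i
    using assms by (simp add: primal_u_def add_nonneg_pos)
  have w': "0 < ?w' j" for j
    using assms by (simp add: dual_v_def add_nonneg_pos)
  have primal: "primal_iterations \<beta> lam X = max_ratio ?w lam (real CARD('n))"
    "T_P \<beta> lam X = (\<lambda>p. max_ratio ?w lam (real CARD('n)) p *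
      (\<Sum>i\<in>UNIV. p $ i * real (nnz (row i X))))"
    "p_star \<beta> lam X = normalized ?w"
    by (simp_all add: fun_eq_iff primal_iterations_def T_P_def primal_cost_def max_ratio_def
        p_star_def normalized_def)
  have dual: "dual_iterations \<beta> lam X = max_ratio ?w' lam (real CARD('n))"
    "T_D \<beta> lam X = (\<lambda>q. max_ratio ?w' lam (real CARD('n)) q *
      (\<Sum>j\<in>UNIV. q $ j * real (nnz (column j X))))"
    "q_star \<beta> lam X = normalized ?w'"
    by (simp_all add: fun_eq_iff dual_iterations_def T_D_def dual_cost_def max_ratio_def
        q_star_def normalized_def)
  show ?thesis
    unfolding primal_importance_sampling_def dual_importance_sampling_def primal dual
    using max_ratio_is_arg_min_iff[of ?w, OF w assms(2) n]
      max_ratio_is_arg_min_iff[of ?w', OF w' assms(2) n]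
      normalized_is_arg_min[of ?w, OF w assms(2) n, of "\<lambda>i. real (nnz (row i X))"]
      normalized_is_arg_min[of ?w', OF w' assms(2) n, of "\<lambda>j. real (nnz (column j X))"]
      is_arg_min_iff_normalized[of ?w, OF w assms(2) n, of "\<lambda>i. real (nnz (row i X))"]
      is_arg_min_iff_normalized[of ?w', OF w' assms(2) n, of "\<lambda>j. real (nnz (column j X))"]
    by (simp add: nnz_pos_iff)
qed

end
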